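(* Let $p$ be a prime, let $S$ be a $p$-group, let $\mathcal{F}$ be a saturated fusion system on $S$ and let $E\leq S$ be a pearl. Then every subgroup of $S$ containing $E$ has maximal nilpotency class. In particular $S$ has maximal nilpotency class.
   Context: All groups are finite. A fusion system $\mathcal{F}$ on a $p$-group $S$ is a category whose objects are the subgroups of $S$ and whose morphism sets $\mathrm{Hom}_{\mathcal{F}}(P,Q)$ consist of injective homomorphisms $P\to Q$, contain all restrictions of conjugation maps by elements of $S$ carrying $P$ into $Q$, and such that every morphism is an $\mathcal{F}$-isomorphism onto its image (with inverse in $\mathcal{F}$) followed by an inclusion. It is saturated if it satisfies the usual saturation axioms of Puig / Broto--Levi--Oliver. Morphisms are written on the right. $\mathrm{Out}_{\mathcal{F}}(P)=\mathrm{Aut}_{\mathcal{F}}(P)/\mathrm{Inn}(P)$. A subgroup $E\leq S$ is $\mathcal{F}$-essential if: $C_S(E\alpha)\leq E\alpha$ for all $\alpha\in\mathrm{Hom}_{\mathcal{F}}(E,S)$; $|N_S(E)|\geq |N_S(E\alpha)|$ for all $\alpha\in\mathrm{Hom}_{\mathcal{F}}(E,S)$; and $\mathrm{Out}_{\mathcal{F}}(E)$ contains a strongly $p$-embedded subgroup (a proper subgroup $H$ of $G$ such that $p$ divides $|H|$ and $p$ does not divide $|H\cap H^g|$ for every $g\in G\setminus H$). A pearl is an $\mathcal{F}$-essential subgroup that is either elementary abelian of order $p^2$ or non-abelian of order $p^3$. A $p$-group of order $p^n$ has maximal nilpotency class if its nilpotency class is $n-1$. *)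

theory Defs
  imports
    "HOL-Algebra.Generated_Groups"
    "HOL-Algebra.Group_Action"
    "HOL-Computational_Algebra.Primes"
begin

section \<open>p-groups and nilpotency class\<close>

locale p_group = group G for p :: nat and G (structure) +
  assumes prime_p: "prime p"
    and finite_carrier: "finite (carrier G)"
    and order_power: "\<exists>n. order G = p ^ n"

definition centralizer :: "('a, 'b) monoid_scheme \<Rightarrow> 'a set \<Rightarrow> 'a set" where
  "centralizer G H = {x \<in> carrier G. \<forall>h\<in>H. x \<otimes>\<^bsub>G\<^esub> h = h \<otimes>\<^bsub>G\<^esub> x}"

definition sylow_subgroup :: "nat \<Rightarrow> ('a, 'b) monoid_scheme \<Rightarrow> 'a set \<Rightarrow> bool" where
  "sylow_subgroup p G H \<longleftrightarrow> subgroup H G \<and> card H = p ^ multiplicity p (order G)"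

text \<open>The commutator subgroup \<open>[H, K]\<close>, with the same convention for commutators as
  \<^const>\<open>derived\<close>; in particular \<open>[H, H]\<close> is \<open>derived G H\<close>.\<close>

definition commutator_subgroup :: "('a, 'b) monoid_scheme \<Rightarrow> 'a set \<Rightarrow> 'a set \<Rightarrow> 'a set" where
  "commutator_subgroup G H K =
     generate G {h \<otimes>\<^bsub>G\<^esub> k \<otimes>\<^bsub>G\<^esub> inv\<^bsub>G\<^esub> h \<otimes>\<^bsub>G\<^esub> inv\<^bsub>G\<^esub> k | h k. h \<in> H \<and> k \<in> K}"

text \<open>Indexed from 0, so \<open>lower_central G n\<close> is usually written \<open>\<gamma>\<close> with index \<open>n + 1\<close>.\<close>

primrec lower_central :: "('a, 'b) monoid_scheme \<Rightarrow> nat \<Rightarrow> 'a set" where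
  "lower_central G 0 = carrier G"
| "lower_central G (Suc n) = commutator_subgroup G (lower_central G n) (carrier G)"

definition has_nilpotency_class :: "('a, 'b) monoid_scheme \<Rightarrow> nat \<Rightarrow> bool" where
  "has_nilpotency_class G c \<longleftrightarrow>
     lower_central G c = {\<one>\<^bsub>G\<^esub>} \<and> (\<forall>k<c. lower_central G k \<noteq> {\<one>\<^bsub>G\<^esub>})"

text \<open>The condition \<open>0 < n\<close> only prevents the truncated subtraction from making the trivial
  group (of class 0) a group of maximal class.\<close>

definition maximal_class :: "nat \<Rightarrow> ('a, 'b) monoid_scheme \<Rightarrow> bool" where
  "maximal_class p G \<longleftrightarrow> p_group p G \<and>
     (\<exists>n. 0 < n \<and> order G = p ^ n \<and> has_nilpotency_class G (n - 1))"


section \<open>Fusion systems\<close>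

text \<open>\<open>conj_map S x P\<close> is the map sending \<open>y\<close> in \<open>P\<close> to its conjugate by \<open>x\<close>, acting from the
  right. As everywhere below, a map with domain \<open>P\<close> is represented by a function that is
  extensional on \<open>P\<close>, so that a morphism is determined by its values on \<open>P\<close>.\<close>

definition conj_map :: "('a, 'b) monoid_scheme \<Rightarrow> 'a \<Rightarrow> 'a set \<Rightarrow> 'a \<Rightarrow> 'a" where
  "conj_map S x P = (\<lambda>y\<in>P. inv\<^bsub>S\<^esub> x \<otimes>\<^bsub>S\<^esub> y \<otimes>\<^bsub>S\<^esub> x)"

text \<open>\<open>F P Q\<close> is the set of morphisms from \<open>P\<close> to \<open>Q\<close>; its values are only relevant for
  subgroups \<open>P\<close> and \<open>Q\<close> of \<open>S\<close>. Identities, and more generally inclusions, are conjugation maps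
  by the neutral element.\<close>

locale fusion_system = p_group p S for p and S (structure) +
  fixes F :: "'a set \<Rightarrow> 'a set \<Rightarrow> ('a \<Rightarrow> 'a) set"
  assumes morphism_mon: "\<lbrakk>subgroup P S; subgroup Q S\<rbrakk> \<Longrightarrow>
      F P Q \<subseteq> mon (S\<lparr>carrier := P\<rparr>) (S\<lparr>carrier := Q\<rparr>) \<inter> extensional P"
    and morphism_compose: "\<lbrakk>subgroup P S; subgroup Q S; subgroup R S; \<phi> \<in> F P Q; \<psi> \<in> F Q R\<rbrakk> \<Longrightarrow>
      compose P \<psi> \<phi> \<in> F P R"
    and conj_map_morphism: "\<lbrakk>subgroup P S; subgroup Q S; x \<in> carrier S; conj_map S x P ` P \<subseteq> Q\<rbrakk> \<Longrightarrow>
      conj_map S x P \<in> F P Q"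
    and morphism_onto_image: "\<lbrakk>subgroup P S; subgroup Q S; \<phi> \<in> F P Q\<rbrakk> \<Longrightarrow>
      \<phi> \<in> F P (\<phi> ` P) \<and> restrict (inv_into P \<phi>) (\<phi> ` P) \<in> F (\<phi> ` P) P"

definition Aut_S :: "('a, 'b) monoid_scheme \<Rightarrow> 'a set \<Rightarrow> ('a \<Rightarrow> 'a) set" where
  "Aut_S S P = (\<lambda>x. conj_map S x P) ` normalizer S P"

definition Inn :: "('a, 'b) monoid_scheme \<Rightarrow> 'a set \<Rightarrow> ('a \<Rightarrow> 'a) set" where
  "Inn S P = (\<lambda>x. conj_map S x P) ` P"

text \<open>The library multiplies automorphisms as functions on the left. With automorphisms acting on
  the right one obtains the opposite groups, which are isomorphic to these, and sets that are
  subgroups, Sylow subgroups or strongly embedded subgroups remain so.\<close>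

definition Aut_F ::
    "('a, 'b) monoid_scheme \<Rightarrow> ('a set \<Rightarrow> 'a set \<Rightarrow> ('a \<Rightarrow> 'a) set) \<Rightarrow> 'a set \<Rightarrow> ('a \<Rightarrow> 'a) monoid" where
  "Aut_F S F P = AutoGroup (S\<lparr>carrier := P\<rparr>) \<lparr>carrier := F P P\<rparr>"

definition Out_F ::
    "('a, 'b) monoid_scheme \<Rightarrow> ('a set \<Rightarrow> 'a set \<Rightarrow> ('a \<Rightarrow> 'a) set) \<Rightarrow> 'a set \<Rightarrow> ('a \<Rightarrow> 'a) set monoid" where
  "Out_F S F P = Aut_F S F P Mod Inn S P"

definition fully_centralized ::
    "('a, 'b) monoid_scheme \<Rightarrow> ('a set \<Rightarrow> 'a set \<Rightarrow> ('a \<Rightarrow> 'a) set) \<Rightarrow> 'a set \<Rightarrow> bool" where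
  "fully_centralized S F P \<longleftrightarrow>
     (\<forall>\<alpha>\<in>F P (carrier S). card (centralizer S (\<alpha> ` P)) \<le> card (centralizer S P))"

definition fully_normalized ::
    "('a, 'b) monoid_scheme \<Rightarrow> ('a set \<Rightarrow> 'a set \<Rightarrow> ('a \<Rightarrow> 'a) set) \<Rightarrow> 'a set \<Rightarrow> bool" where
  "fully_normalized S F P \<longleftrightarrow>
     (\<forall>\<alpha>\<in>F P (carrier S). card (normalizer S (\<alpha> ` P)) \<le> card (normalizer S P))"

text \<open>The usual \<open>N\<close> with index \<open>\<phi>\<close>: the elements \<open>g\<close> normalizing \<open>P\<close> such that conjugation by
  \<open>g\<close>, transported along \<open>\<phi>\<close>, is induced by an element of \<open>S\<close>.\<close>

definition extension_domain :: "('a, 'b) monoid_scheme \<Rightarrow> 'a set \<Rightarrow> ('a \<Rightarrow> 'a) \<Rightarrow> 'a set" where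
  "extension_domain S P \<phi> =
     {g \<in> normalizer S P. (\<lambda>y\<in>\<phi> ` P. \<phi> (conj_map S g P (inv_into P \<phi> y))) \<in> Aut_S S (\<phi> ` P)}"

text \<open>Saturation in the form of Broto, Levi and Oliver.\<close>

locale saturated_fusion_system = fusion_system +
  assumes sylow_axiom: "\<lbrakk>subgroup P S; fully_normalized S F P\<rbrakk> \<Longrightarrow>
      fully_centralized S F P \<and> sylow_subgroup p (Aut_F S F P) (Aut_S S P)"
    and extension_axiom:
      "\<lbrakk>subgroup P S; \<phi> \<in> F P (carrier S); fully_centralized S F (\<phi> ` P)\<rbrakk> \<Longrightarrow>
      \<exists>\<psi>\<in>F (extension_domain S P \<phi>) (carrier S). restrict \<psi> P = \<phi>"


section \<open>Essential subgroups and pearls\<close>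

definition strongly_embedded :: "nat \<Rightarrow> ('a, 'b) monoid_scheme \<Rightarrow> 'a set \<Rightarrow> bool" where
  "strongly_embedded p G H \<longleftrightarrow> subgroup H G \<and> H \<noteq> carrier G \<and> p dvd card H \<and>
     (\<forall>g\<in>carrier G - H. \<not> p dvd card (H \<inter> (inv\<^bsub>G\<^esub> g <#\<^bsub>G\<^esub> H #>\<^bsub>G\<^esub> g)))"

definition essential ::
    "nat \<Rightarrow> ('a, 'b) monoid_scheme \<Rightarrow> ('a set \<Rightarrow> 'a set \<Rightarrow> ('a \<Rightarrow> 'a) set) \<Rightarrow> 'a set \<Rightarrow> bool" where
  "essential p S F E \<longleftrightarrow> subgroup E S \<and>
     (\<forall>\<alpha>\<in>F E (carrier S). centralizer S (\<alpha> ` E) \<subseteq> \<alpha> ` E) \<and>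
     fully_normalized S F E \<and>
     (\<exists>H. strongly_embedded p (Out_F S F E) H)"

definition elementary_abelian :: "nat \<Rightarrow> ('a, 'b) monoid_scheme \<Rightarrow> bool" where
  "elementary_abelian p G \<longleftrightarrow> comm_group G \<and> (\<forall>x\<in>carrier G. x [^]\<^bsub>G\<^esub> p = \<one>\<^bsub>G\<^esub>)"

definition pearl ::
    "nat \<Rightarrow> ('a, 'b) monoid_scheme \<Rightarrow> ('a set \<Rightarrow> 'a set \<Rightarrow> ('a \<Rightarrow> 'a) set) \<Rightarrow> 'a set \<Rightarrow> bool" where
  "pearl p S F E \<longleftrightarrow> essential p S F E \<and>
     (elementary_abelian p (S\<lparr>carrier := E\<rparr>) \<and> card E = p ^ 2 \<or>
      \<not> comm_group (S\<lparr>carrier := E\<rparr>) \<and> card E = p ^ 3)"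

end

theory Submission
  imports Defs
begin

text \<open>
  Saturation plays no role: all that is used of a pearl \<open>E\<close> is \<open>C\<^sub>S(E) \<le> E\<close>. Let \<open>G\<close> be a subgroup
  of \<open>S\<close> containing \<open>E\<close>. If \<open>|E| = p\<^sup>2\<close> and \<open>E < G\<close>, then \<open>Z(G)\<close> has order \<open>p\<close>, and the
  centralizer \<open>N\<close> of \<open>E\<close> modulo \<open>Z(G)\<close> has order \<open>p\<^sup>3\<close>; as \<open>N \<ge> E\<close>, the subgroup \<open>N / Z(G)\<close> of order
  \<open>p\<^sup>2\<close> is self-centralizing in \<open>G / Z(G)\<close>. By induction \<open>G / Z(G)\<close> has maximal class, hence so
  does \<open>G\<close> (Suzuki). If \<open>E\<close> is non-abelian of order \<open>p\<^sup>3\<close>, then \<open>Z(G) = Z(E)\<close>, and an element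
  centralizing \<open>E\<close> modulo \<open>Z(E)\<close> induces on \<open>E\<close> one of the \<open>p\<^sup>2\<close> inner automorphisms, so that
  \<open>E / Z(E)\<close> is self-centralizing of order \<open>p\<^sup>2\<close> in \<open>G / Z(G)\<close>.

  Passing to a quotient changes the type of the elements, so the induction takes place
  inside a fixed group \<open>G\<close>, all notions being taken modulo a varying normal subgroup \<open>Z\<close>.
\<close>

section \<open>Centres and subgroup orders in p-groups\<close>

text \<open>Class equation: if only the identity were central, every other conjugacy class would
  have size divisible by \<open>p\<close>, so the order of \<open>G\<close> would be 1 modulo
  \<open>p\<close>, although \<open>p\<close> divides it.\<close>

lemma (in p_group) exists_central:
  assumes "order G \<noteq> 1"
  shows "\<exists>z\<in>carrier G. z \<noteq> \<one> \<and> (\<forall>x\<in>carrier G. z \<otimes> x = x \<otimes> z)"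
proof (rule ccontr)
  assume no_central: "\<not> ?thesis"
  define \<phi> where "\<phi> = (\<lambda>g. \<lambda>h\<in>carrier G. g \<otimes> h \<otimes> inv g)"
  interpret conj: group_action G "carrier G" \<phi>
    unfolding \<phi>_def by (rule action_by_conjugation)
  let ?O = "orbits G (carrier G) \<phi>"
  have fin: "finite ?O" "\<And>X. X \<in> ?O \<Longrightarrow> finite X"
    using finite_carrier conj.orbits_coverture by (auto intro: finite_UnionD finite_subset)
  have dvd_orbit: "p dvd card (orbit G \<phi> x)" if x: "x \<in> carrier G" "x \<noteq> \<one>" for x
  proof -
    obtain g where g: "g \<in> carrier G" "x \<otimes> g \<noteq> g \<otimes> x"
      using no_central x by blast
    have "\<phi> g x \<in> orbit G \<phi> x" "x \<in> orbit G \<phi> x"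
      using g conj.orbit_refl[OF x(1)] by (auto simp: orbit_def)
    moreover have "\<phi> g x \<noteq> x"
      using g x by (metis \<phi>_def inv_solve_right m_closed restrict_apply')
    moreover have "finite (orbit G \<phi> x)"
      using fin(2) x(1) by (auto simp: orbits_def)
    ultimately have "card (orbit G \<phi> x) \<noteq> 1"
      by (metis card_1_singletonE singletonD)
    moreover have "card (orbit G \<phi> x) dvd order G"
      using conj.orbit_stabilizer_theorem[OF x(1)] by (metis dvd_triv_left)
    ultimately show ?thesis
      using order_power prime_p by (metis dvd_power divides_primepow_nat gr0I power_0)
  qed
  have "\<phi> g \<one> = \<one>" if "g \<in> carrier G" for g
    using that by (simp add: \<phi>_def)
  then have "(\<lambda>g. \<phi> g \<one>) ` carrier G = (\<lambda>_. \<one>) ` carrier G"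
    by (rule image_cong[OF refl])
  then have one: "orbit G \<phi> \<one> = {\<one>}"
    unfolding orbit_def Setcompr_eq_image using one_closed by (simp only: image_constant)
  have one_in: "{\<one>} \<in> ?O"
    unfolding orbits_def using one one_closed by (intro CollectI exI[of _ \<one>]) simp
  have "p dvd card X" if X: "X \<in> ?O - {{\<one>}}" for X
  proof -
    obtain x where "x \<in> carrier G" "X = orbit G \<phi> x"
      using X unfolding orbits_def by blast
    then show ?thesis using X one dvd_orbit[of x] by blast
  qed
  then have "p dvd (\<Sum>X\<in>?O - {{\<one>}}. card X)"
    by (intro dvd_sum)
  moreover have "(\<Sum>X\<in>?O. card X) = order G"
    using conj.disjoint_sum[OF finite_carrier, of "\<lambda>_. 1 :: nat"] by (simp add: order_def)
  then have "1 + (\<Sum>X\<in>?O - {{\<one>}}. card X) = order G"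
    using sum.remove[OF fin(1) one_in, of card] by simp
  moreover have "p dvd order G"
  proof -
    obtain n where "order G = p ^ n" using order_power by blast
    then show ?thesis using assms by (cases n) simp_all
  qed
  ultimately show False
    using prime_gt_1_nat[OF prime_p] by (metis dvd_add_left_iff nat_dvd_1_iff_1 less_irrefl)
qed

lemma (in p_group) p_group_subgroup:
  assumes "subgroup H G"
  shows "p_group p (G\<lparr>carrier := H\<rparr>)"
proof -
  have "card H dvd order G"
    using lagrange[OF assms] by (metis dvd_triv_right)
  then have "\<exists>n. card H = p ^ n"
    using order_power prime_p by (metis divides_primepow_nat)
  then show ?thesis
    using assms prime_p finite_carrier subgroup.subset[OF assms]
    by (auto simp: p_group_def p_group_axioms_def order_def subgroup.subgroup_is_group is_group
        intro: finite_subset)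
qed

lemma (in p_group) p_group_factgroup:
  assumes "N \<lhd> G"
  shows "p_group p (G Mod N)"
proof -
  have "card (rcosets N) dvd order G"
    using lagrange[OF normal_imp_subgroup[OF assms]] by (metis dvd_triv_left)
  then have "\<exists>n. card (rcosets N) = p ^ n"
    using order_power prime_p by (metis divides_primepow_nat)
  moreover have "finite (rcosets N)"
    using finite_carrier by (auto simp: RCOSETS_def)
  ultimately show ?thesis
    using normal.factorgroup_is_group[OF assms] prime_p
    by (intro p_group.intro p_group_axioms.intro) (simp_all add: order_def FactGroup_def)
qed

lemma (in p_group) card_subgroup_pos:
  assumes "subgroup H G"
  shows "card H > 0"
  using assms finite_carrier
  by (metis card_gt_0_iff empty_iff finite_subset subgroup.one_closed subgroup.subset)

text \<open>The index of \<open>K\<close> in \<open>H\<close> is a power of \<open>p\<close> other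
  than 1.\<close>

lemma (in p_group) p_card_dvd_card:
  assumes "subgroup K G" "subgroup H G" "K \<subset> H"
  shows "p * card K dvd card H"
proof -
  interpret H: p_group p "G\<lparr>carrier := H\<rparr>"
    using p_group_subgroup assms(2) .
  have fin: "finite H" using H.finite_carrier by simp
  have "subgroup K (G\<lparr>carrier := H\<rparr>)"
    using assms by (simp add: subgroup_incl)
  then have "card (rcosets\<^bsub>G\<lparr>carrier := H\<rparr>\<^esub> K) * card K = card H"
    using H.lagrange[of K] by (simp add: order_def)
  then obtain q where q: "card H = q * card K"
    using that[of "card (rcosets\<^bsub>G\<lparr>carrier := H\<rparr>\<^esub> K)"] by simp
  have "q \<noteq> 1" using q assms(3) fin by (metis nat_mult_1 psubset_card_mono order_less_irrefl)
  obtain n where "card H = p ^ n" using H.order_power by (auto simp: order_def)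
  then obtain i where "q = p ^ i"
    using q divides_primepow_nat[OF prime_p] by (metis dvd_triv_left)
  then have "p dvd q" using \<open>q \<noteq> 1\<close> by (cases i) simp_all
  then show ?thesis using q by auto
qed

section \<open>Centralizers modulo a normal subgroup\<close>

text \<open>For normal \<open>Z\<close> and \<open>H\<close> inside \<open>G\<close>, this is the
  full preimage in \<open>G\<close> of the centralizer of the image of \<open>H\<close> in
  \<open>G / Z\<close>. With \<open>H = carrier G\<close> it is the preimage of the centre of
  \<open>G / Z\<close>.\<close>

definition centralizer_mod :: "('a, 'b) monoid_scheme \<Rightarrow> 'a set \<Rightarrow> 'a set \<Rightarrow> 'a set" where
  "centralizer_mod G Z H = {x \<in> carrier G. \<forall>h\<in>H. Z #>\<^bsub>G\<^esub> (x \<otimes>\<^bsub>G\<^esub> h) = Z #>\<^bsub>G\<^esub> (h \<otimes>\<^bsub>G\<^esub> x)}"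

lemma (in group) centralizer_mod_one:
  assumes "H \<subseteq> carrier G"
  shows "centralizer_mod G {\<one>} H = centralizer G H"
proof -
  have "{\<one>} #> y = {y}" if "y \<in> carrier G" for y
    using that by (simp add: r_coset_def)
  then show ?thesis
    using assms by (auto simp: centralizer_mod_def centralizer_def subset_iff)
qed

lemma (in normal) rcos_eq_iff:
  assumes "x \<in> carrier G" "y \<in> carrier G"
  shows "H #> x = H #> y \<longleftrightarrow> x \<otimes> inv y \<in> H"
  using assms subgroup_axioms
  by (metis coset_join1 coset_join2 coset_mult_inv1 coset_mult_inv2 inv_closed m_closed subset)

lemma (in normal) mem_centralizer_mod_iff:
  assumes "K \<subseteq> carrier G"
  shows "x \<in> centralizer_mod G H K \<longleftrightarrow>
    x \<in> carrier G \<and> (\<forall>k\<in>K. x \<otimes> k \<otimes> inv x \<otimes> inv k \<in> H)"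
proof -
  have "H #> (x \<otimes> k) = H #> (k \<otimes> x) \<longleftrightarrow> x \<otimes> k \<otimes> inv x \<otimes> inv k \<in> H"
    if "x \<in> carrier G" "k \<in> K" for k
    using that assms by (subst rcos_eq_iff) (auto simp: subset_iff inv_mult_group m_assoc)
  then show ?thesis by (auto simp: centralizer_mod_def)
qed

lemma (in normal) subgroup_centralizer_mod:
  assumes "K \<subseteq> carrier G"
  shows "subgroup (centralizer_mod G H K) G"
proof
  show "centralizer_mod G H K \<subseteq> carrier G"
    by (auto simp: centralizer_mod_def)
  show "\<one> \<in> centralizer_mod G H K"
    using assms by (auto simp: centralizer_mod_def subset_iff)
next
  fix x y assume xy: "x \<in> centralizer_mod G H K" "y \<in> centralizer_mod G H K"
  then have c: "x \<in> carrier G" "y \<in> carrier G"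
    by (auto simp: centralizer_mod_def)
  have "H #> (x \<otimes> y \<otimes> k) = H #> (k \<otimes> (x \<otimes> y))" if k: "k \<in> K" for k
  proof -
    have kc: "k \<in> carrier G" using k assms by auto
    have "H #> (x \<otimes> y \<otimes> k) = (H #> x) <#> (H #> (y \<otimes> k))"
      using c kc by (simp add: rcos_sum m_assoc)
    also have "\<dots> = (H #> x) <#> (H #> (k \<otimes> y))"
      using xy k by (simp add: centralizer_mod_def)
    also have "\<dots> = (H #> (x \<otimes> k)) <#> (H #> y)"
      using c kc by (simp add: rcos_sum m_assoc)
    also have "\<dots> = (H #> (k \<otimes> x)) <#> (H #> y)"
      using xy k by (simp add: centralizer_mod_def)
    also have "\<dots> = H #> (k \<otimes> (x \<otimes> y))"
      using c kc by (simp add: rcos_sum m_assoc)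
    finally show ?thesis .
  qed
  then show "x \<otimes> y \<in> centralizer_mod G H K"
    using c by (simp add: centralizer_mod_def)
next
  fix x assume x: "x \<in> centralizer_mod G H K"
  then have c: "x \<in> carrier G"
    by (auto simp: centralizer_mod_def)
  have "H #> (inv x \<otimes> k) = H #> (k \<otimes> inv x)" if k: "k \<in> K" for k
  proof -
    have kc: "k \<in> carrier G" using k assms by auto
    have "H #> (inv x \<otimes> k) = (H #> inv x) <#> (H #> (k \<otimes> x)) <#> (H #> inv x)"
      using c kc by (simp add: rcos_sum m_assoc)
    also have "\<dots> = (H #> inv x) <#> (H #> (x \<otimes> k)) <#> (H #> inv x)"
      using x k by (simp add: centralizer_mod_def)
    also have "\<dots> = H #> (k \<otimes> inv x)"
      using c kc by (simp add: rcos_sum m_assoc[symmetric])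
    finally show ?thesis .
  qed
  then show "inv x \<in> centralizer_mod G H K"
    using c by (simp add: centralizer_mod_def)
qed

lemma (in normal) subset_centralizer_mod:
  assumes "K \<subseteq> carrier G"
  shows "H \<subseteq> centralizer_mod G H K"
proof
  fix x assume x: "x \<in> H"
  have "k \<otimes> inv x \<otimes> inv k \<in> H" if "k \<in> K" for k
    using that x assms inv_op_closed2[of k "inv x"] by (auto simp: subset_iff)
  then show "x \<in> centralizer_mod G H K"
    using x assms by (auto simp: mem_centralizer_mod_iff m_assoc subset_iff)
qed

lemma (in normal) normal_centralizer_mod_carrier:
  "centralizer_mod G H (carrier G) \<lhd> G"
  unfolding normal_inv_iff
proof (intro conjI ballI subgroup_centralizer_mod subset_refl)
  fix g x assume g: "g \<in> carrier G" and x: "x \<in> centralizer_mod G H (carrier G)"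
  have xc: "x \<in> carrier G" using x by (simp add: centralizer_mod_def)
  \<comment> \<open>The conjugate of \<open>x\<close> by \<open>g\<close> is \<open>x\<close>
    multiplied on the left by a conjugate of this commutator, which lies in \<open>H\<close> and so
    in the centralizer.\<close>
  have "x \<otimes> inv g \<otimes> inv x \<otimes> g \<in> H"
    using x g mem_centralizer_mod_iff[OF subset_refl, of x] by (metis inv_closed inv_inv)
  then have "g \<otimes> (x \<otimes> inv g \<otimes> inv x \<otimes> g) \<otimes> inv g \<in> centralizer_mod G H (carrier G)"
    using subset_centralizer_mod[OF subset_refl] inv_op_closed2 g by blast
  then have "g \<otimes> (x \<otimes> inv g \<otimes> inv x \<otimes> g) \<otimes> inv g \<otimes> x \<in> centralizer_mod G H (carrier G)"
    using x subgroup_centralizer_mod[OF subset_refl] by (simp add: subgroup.m_closed)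
  then show "g \<otimes> x \<otimes> inv g \<in> centralizer_mod G H (carrier G)"
    using g xc by (simp add: m_assoc)
qed

text \<open>The non-trivial centre of the p-group \<open>G / Z\<close>, pulled back to
  \<open>G\<close>.\<close>

lemma (in p_group) center_mod_psupset:
  assumes "Z \<lhd> G" "Z \<noteq> carrier G"
  shows "Z \<subset> centralizer_mod G Z (carrier G)"
proof -
  interpret normal Z G by fact
  interpret Q: p_group p "G Mod Z" using p_group_factgroup[OF assms(1)] .
  have "order (G Mod Z) \<noteq> 1"
  proof
    assume "order (G Mod Z) = 1"
    then have "card (rcosets Z) = 1" by (simp add: order_def FactGroup_def)
    then have "card Z = card (carrier G)"
      using lagrange[OF subgroup_axioms] by (simp add: order_def)
    then show False using assms(2) finite_carrier subset card_subset_eq by blast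
  qed
  then obtain zZ where zZ: "zZ \<in> carrier (G Mod Z)" "zZ \<noteq> Z"
      "\<forall>X\<in>carrier (G Mod Z). zZ \<otimes>\<^bsub>G Mod Z\<^esub> X = X \<otimes>\<^bsub>G Mod Z\<^esub> zZ"
    using Q.exists_central by (auto simp: FactGroup_def)
  then obtain z where z: "z \<in> carrier G" "zZ = Z #> z"
    by (auto simp: FactGroup_def RCOSETS_def)
  have "Z #> (z \<otimes> x) = Z #> (x \<otimes> z)" if x: "x \<in> carrier G" for x
  proof -
    have "Z #> x \<in> rcosets Z" using x by (auto simp: RCOSETS_def)
    then have "(Z #> z) <#> (Z #> x) = (Z #> x) <#> (Z #> z)"
      using zZ(3) z(2) by (simp add: FactGroup_def)
    then show ?thesis using z(1) x by (simp add: rcos_sum)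
  qed
  then have "z \<in> centralizer_mod G Z (carrier G)"
    using z by (simp add: centralizer_mod_def)
  moreover have "z \<notin> Z" using z zZ(2) by (metis rcos_const is_group)
  ultimately show ?thesis using subset_centralizer_mod by blast
qed


lemma centralizer_mod_antimono:
  "K \<subseteq> L \<Longrightarrow> centralizer_mod G Z L \<subseteq> centralizer_mod G Z K"
  by (auto simp: centralizer_mod_def)

lemma (in group) centralizer_mod_mono:
  assumes "Y \<lhd> G" "Z \<lhd> G" "Y \<subseteq> Z" "K \<subseteq> carrier G"
  shows "centralizer_mod G Y K \<subseteq> centralizer_mod G Z K"
  using assms by (simp add: normal.mem_centralizer_mod_iff subset_iff)

lemma subset_centralizer_mod_sym:
  assumes "K \<subseteq> carrier G" "L \<subseteq> carrier G"
  shows "K \<subseteq> centralizer_mod G Z L \<longleftrightarrow> L \<subseteq> centralizer_mod G Z K"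
  using assms by (auto simp: centralizer_mod_def subset_iff)

text \<open>Modulo \<open>Z\<close>, an element \<open>x\<close> outside the centre commutes with
  the centre and with itself. Were the centre of index \<open>p\<close>, the centralizer of
  \<open>x\<close> would be all of \<open>G\<close>, making \<open>x\<close> central.\<close>

lemma (in p_group) order_neq_p_center_mod:
  assumes "Z \<lhd> G"
  shows "order G \<noteq> p * card (centralizer_mod G Z (carrier G))"
proof
  interpret normal Z G by fact
  let ?W = "centralizer_mod G Z (carrier G)"
  assume eq: "order G = p * card ?W"
  have W: "subgroup ?W G" by (simp add: subgroup_centralizer_mod)
  have "card ?W > 0"
    using W by (rule card_subgroup_pos)
  then have "card ?W \<noteq> card (carrier G)"
    using eq prime_gt_1_nat[OF prime_p] unfolding order_def by (metis mult_eq_self_implies_10 less_irrefl mult.commute)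
  then have "?W \<noteq> carrier G" by metis
  then obtain x where x: "x \<in> carrier G" "x \<notin> ?W"
    using W subgroup.subset by blast
  let ?K = "centralizer_mod G Z {x}"
  have K: "subgroup ?K G" using x by (simp add: subgroup_centralizer_mod)
  have "?W \<subseteq> ?K" using x by (simp add: centralizer_mod_antimono)
  moreover have "x \<in> ?K" using x by (simp add: centralizer_mod_def)
  ultimately have "p * card ?W dvd card ?K"
    using x by (intro p_card_dvd_card[OF W K]) auto
  then have "order G \<le> card ?K"
    using eq card_subgroup_pos[OF K] by (simp add: dvd_imp_le)
  then have "?K = carrier G"
    using K finite_carrier subgroup.subset by (metis card_seteq order_def)
  then have "{x} \<subseteq> ?W"
    using x by (subst subset_centralizer_mod_sym) auto
  then show False using x by simp
qed

text \<open>In the group \<open>G / Z\<close> of order \<open>p^2\<close> the centre is non-trivial;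
  if proper, it would have index \<open>p\<close>, which is excluded above.\<close>

lemma (in p_group) center_mod_eq_carrier:
  assumes "Z \<lhd> G" "order G = p\<^sup>2 * card Z"
  shows "centralizer_mod G Z (carrier G) = carrier G"
proof (rule ccontr)
  interpret normal Z G by fact
  let ?W = "centralizer_mod G Z (carrier G)"
  assume ne: "?W \<noteq> carrier G"
  have W: "subgroup ?W G" by (simp add: subgroup_centralizer_mod)
  have "Z \<noteq> carrier G"
    using assms(2) one_less_power[OF prime_gt_1_nat[OF prime_p], of 2] card_subgroup_pos[OF subgroup_axioms]
    by (auto simp: order_def)
  then have "p * card Z dvd card ?W"
    using center_mod_psupset[OF assms(1)] p_card_dvd_card[OF subgroup_axioms W] by blast
  then have "p * (p * card Z) \<le> p * card ?W"
    using card_subgroup_pos[OF W] by (simp add: dvd_imp_le)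
  moreover have "p * card ?W dvd card (carrier G)"
    using ne W subgroup_self subgroup.subset by (intro p_card_dvd_card) blast+
  then have "p * card ?W \<le> order G"
    using card_subgroup_pos[OF subgroup_self] by (simp add: dvd_imp_le order_def)
  ultimately have "order G = p * card ?W"
    using assms(2) prime_gt_0_nat[OF prime_p] by (simp add: power2_eq_square)
  then show False using order_neq_p_center_mod[OF assms(1)] by simp
qed

lemma (in p_group) subgroup_subset_centralizer_mod:
  assumes "Z \<lhd> G" "subgroup N G" "Z \<subseteq> N" "card N = p\<^sup>2 * card Z"
  shows "N \<subseteq> centralizer_mod G Z N"
proof -
  interpret N: p_group p "G\<lparr>carrier := N\<rparr>"
    using p_group_subgroup assms(2) .
  have "Z \<lhd> G\<lparr>carrier := N\<rparr>"
    using assms by (simp add: normal_restrict_supergroup)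
  then have "centralizer_mod (G\<lparr>carrier := N\<rparr>) Z N = N"
    using N.center_mod_eq_carrier assms(4) by (simp add: order_def)
  moreover have "centralizer_mod (G\<lparr>carrier := N\<rparr>) Z N \<subseteq> centralizer_mod G Z N"
    using subgroup.subset[OF assms(2)] by (auto simp: centralizer_mod_def r_coset_def)
  ultimately show ?thesis by simp
qed

section \<open>The lower central series modulo a normal subgroup\<close>

lemma (in group) lower_central_subset:
  "lower_central G k \<subseteq> carrier G"
proof (induction k)
  case (Suc k)
  then show ?case
    unfolding lower_central.simps commutator_subgroup_def
    by (intro generate_subgroup_incl[OF _ subgroup_self]) auto
qed simp

lemma (in normal) lower_central_Suc_subset_iff:
  "lower_central G (Suc k) \<subseteq> H \<longleftrightarrow> lower_central G k \<subseteq> centralizer_mod G H (carrier G)"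
proof
  let ?C = "{h \<otimes> x \<otimes> inv h \<otimes> inv x |h x. h \<in> lower_central G k \<and> x \<in> carrier G}"
  assume "lower_central G (Suc k) \<subseteq> H"
  moreover have "?C \<subseteq> generate G ?C"
    using generate.incl by (rule subsetI)
  ultimately have "?C \<subseteq> H"
    unfolding lower_central.simps commutator_subgroup_def by (rule order_trans[rotated])
  then show "lower_central G k \<subseteq> centralizer_mod G H (carrier G)"
    using lower_central_subset[of k] by (fastforce simp: mem_centralizer_mod_iff)
next
  assume "lower_central G k \<subseteq> centralizer_mod G H (carrier G)"
  then show "lower_central G (Suc k) \<subseteq> H"
    unfolding lower_central.simps commutator_subgroup_def
    by (intro generate_subgroup_incl[OF _ subgroup_axioms]) (auto simp: mem_centralizer_mod_iff)
qed

text \<open>Dividing the non-trivial group \<open>G / H\<close> by its centre lowers the class by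
  one. The hypothesis \<open>H \<noteq> carrier G\<close> settles \<open>k = 0\<close>, where the
  term of the series is \<open>G\<close> itself.\<close>

lemma (in normal) lower_central_subset_step:
  assumes "H \<noteq> carrier G"
    and "\<And>k. lower_central G k \<subseteq> centralizer_mod G H (carrier G) \<longleftrightarrow> c \<le> k"
  shows "lower_central G k \<subseteq> H \<longleftrightarrow> Suc c \<le> k"
proof (cases k)
  case 0
  then show ?thesis using assms(1) subset by auto
next
  case (Suc j)
  then show ?thesis using assms(2) lower_central_Suc_subset_iff by simp
qed

section \<open>Counting conjugates modulo normal subgroups\<close>

lemma (in normal) mem_centralizer_mod_of_conj_eq:
  assumes c: "g \<in> carrier G" "h \<in> carrier G" "a \<in> carrier G"
    and eq: "H #> (g \<otimes> a \<otimes> inv g) = H #> (h \<otimes> a \<otimes> inv h)"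
  shows "inv h \<otimes> g \<in> centralizer_mod G H {a}"
proof -
  have "H #> (inv h \<otimes> g \<otimes> a) = (H #> inv h) <#> (H #> (g \<otimes> a \<otimes> inv g)) <#> (H #> g)"
    using c by (simp add: rcos_sum m_assoc)
  also have "\<dots> = (H #> inv h) <#> (H #> (h \<otimes> a \<otimes> inv h)) <#> (H #> g)"
    by (simp add: eq)
  also have "\<dots> = H #> (a \<otimes> (inv h \<otimes> g))"
    using c by (simp add: rcos_sum m_assoc[symmetric])
  finally show ?thesis using c by (simp add: centralizer_mod_def)
qed

text \<open>For \<open>g\<close> in \<open>N\<close> the commutator \<open>[g, a]\<close> lies in
  \<open>Z\<close>, so the conjugate of \<open>a\<close> by \<open>g\<close> falls into one of
  \<open>|Z : Y|\<close> cosets of \<open>Y\<close>. Elements giving the same coset differ by an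
  element of \<open>N\<close> that centralizes \<open>a\<close> modulo \<open>Y\<close>.\<close>

lemma (in group) card_le_card_centralizer_mod:
  assumes fin: "finite (carrier G)"
    and Y: "Y \<lhd> G" and Z: "Z \<lhd> G" "Y \<subseteq> Z"
    and N: "subgroup N G" "N \<subseteq> centralizer_mod G Z {a}" and a: "a \<in> carrier G"
  shows "card N * card Y \<le> card Z * card (N \<inter> centralizer_mod G Y {a})"
proof -
  interpret Y: normal Y G by fact
  let ?K = "N \<inter> centralizer_mod G Y {a}"
  define f where "f g = Y #> (g \<otimes> a \<otimes> inv g)" for g
  define R where "R = rcosets\<^bsub>G\<lparr>carrier := Z\<rparr>\<^esub> Y"
  have Zs: "subgroup Z G" using Z(1) by (rule normal_imp_subgroup)
  have R_eq: "R = (\<lambda>x. Y #> x) ` Z"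
    by (auto simp: R_def RCOSETS_def r_coset_def)
  then have finR: "finite R"
    using fin finite_subset[OF subgroup.subset[OF Zs]] by simp
  have cardR: "card R * card Y = card Z"
    using group.lagrange[OF subgroup.subgroup_is_group[OF Zs is_group], of Y]
      subgroup_incl[OF Y.subgroup_axioms Zs Z(2)] by (simp add: R_def order_def)
  have sub: "f ` N \<subseteq> (\<lambda>C. C #> a) ` R"
  proof
    fix X assume "X \<in> f ` N"
    then obtain g where g: "g \<in> N" "X = f g" by blast
    then have gc: "g \<in> carrier G" "g \<otimes> a \<otimes> inv g \<otimes> inv a \<in> Z"
      using N(2) a normal.mem_centralizer_mod_iff[OF Z(1), of "{a}"] by auto
    then have "X = (Y #> (g \<otimes> a \<otimes> inv g \<otimes> inv a)) #> a"
      using a g by (simp add: f_def Y.subset coset_mult_assoc m_assoc)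
    then show "X \<in> (\<lambda>C. C #> a) ` R"
      using gc(2) by (simp add: R_eq)
  qed
  have finN: "finite N" using N(1) fin finite_subset subgroup.subset by blast
  have fibre: "card {g \<in> N. f g = y} \<le> card ?K" if y: "y \<in> f ` N" for y
  proof -
    obtain h where h: "h \<in> N" "y = f h" using y by blast
    have Nc: "N \<subseteq> carrier G" using N(1) by (rule subgroup.subset)
    have "inj_on (\<lambda>g. inv h \<otimes> g) {g \<in> N. f g = y}"
      using Nc h by (auto simp: inj_on_def subset_iff)
    moreover have "(\<lambda>g. inv h \<otimes> g) ` {g \<in> N. f g = y} \<subseteq> ?K"
      using Nc h a N(1) Y.mem_centralizer_mod_of_conj_eq[of _ h a]
      by (auto simp: f_def subset_iff subgroup.m_closed subgroup.m_inv_closed)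
    ultimately show ?thesis using finN by (auto intro: card_inj_on_le)
  qed
  have "N = (\<Union>y\<in>f ` N. {g \<in> N. f g = y})" by auto
  then have "card N \<le> (\<Sum>y\<in>f ` N. card {g \<in> N. f g = y})"
    using card_UN_le[of "f ` N" "\<lambda>y. {g \<in> N. f g = y}"] finN by simp
  also have "\<dots> \<le> card (f ` N) * card ?K"
    using sum_bounded_above[of "f ` N" "\<lambda>y. card {g \<in> N. f g = y}" "card ?K"] fibre by simp
  also have "\<dots> \<le> card R * card ?K"
    using sub finR by (intro mult_right_mono) (auto intro: surj_card_le)
  finally have "card N * card Y \<le> card R * card ?K * card Y" by (rule mult_right_mono) simp
  then show ?thesis using cardR by (metis mult.assoc mult.commute)
qed

section \<open>Self-centralizing subgroups of order p^2 in a quotient\<close>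

lemma (in p_group) subgroup_eq_of_p_card:
  assumes "subgroup K G" "subgroup H G" "subgroup L G" "K \<subset> H" "H \<subseteq> L" "card L \<le> p * card K"
  shows "H = L"
proof -
  have "p * card K \<le> card H"
    using p_card_dvd_card[OF assms(1,2,4)] card_subgroup_pos[OF assms(2)] by (simp add: dvd_imp_le)
  then show ?thesis
    using assms finite_carrier by (meson card_seteq finite_subset le_trans subgroup.subset)
qed

text \<open>The conclusion says that \<open>G / Z\<close>, a group of order \<open>p ^ Suc c\<close>, has class exactly \<open>c\<close>.\<close>

lemma (in p_group) lower_central_of_self_centralizing_mod:
  assumes "Z \<lhd> G" "subgroup A G" "Z \<subseteq> A" "card A = p\<^sup>2 * card Z"
    and "centralizer_mod G Z A \<subseteq> A" "order G = p ^ Suc c * card Z"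
  shows "lower_central G k \<subseteq> Z \<longleftrightarrow> c \<le> k"
  using assms
proof (induction c arbitrary: Z A k)
  case 0
  \<comment> \<open>This case is vacuous: \<open>A\<close> would have \<open>p^2 |Z|\<close>
    elements inside a group of order \<open>p |Z|\<close>.\<close>
  have "card A \<le> card (carrier G)"
    using 0(2) finite_carrier by (simp add: card_mono subgroup.subset)
  then show ?case
    using 0 prime_gt_1_nat[OF prime_p] card_subgroup_pos[OF normal_imp_subgroup[OF 0(1)]]
    by (simp add: order_def power2_eq_square)
next
  case (Suc c)
  interpret normal Z G by fact
  note pos = card_subgroup_pos[OF subgroup_axioms] prime_gt_1_nat[OF prime_p]
  let ?C = "centralizer_mod G"
  define W where "W = ?C Z (carrier G)"
  have Zne: "Z \<noteq> carrier G"
    using Suc.prems(6) pos by (auto simp: order_def)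
  have W_norm: "W \<lhd> G" unfolding W_def by (rule normal_centralizer_mod_carrier)
  interpret W: normal W G by fact
  have A_sub: "A \<subseteq> carrier G" using Suc.prems(2) by (rule subgroup.subset)
  have ZW: "Z \<subset> W" unfolding W_def by (rule center_mod_psupset[OF Suc.prems(1) Zne])
  show ?case
  proof (cases "A = carrier G")
    case True
    \<comment> \<open>Here \<open>G / Z\<close> has order \<open>p^2\<close>, hence is abelian and
      of class 1, in accordance with \<open>c = 0\<close>.\<close>
    then have "W = carrier G"
      unfolding W_def using Suc.prems by (intro center_mod_eq_carrier) (auto simp: order_def)
    moreover have "p ^ c = 1"
      using Suc.prems(4,6) True pos by (simp add: order_def power2_eq_square)
    then have "c = 0" using pos by (cases c) simp_all
    ultimately show ?thesis
      using lower_central_subset_step[OF Zne, of 0] lower_central_subset by (simp add: W_def)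
  next
    case False
    have WA: "W \<subset> A"
    proof -
      \<comment> \<open>\<open>W\<close> centralizes \<open>A\<close> modulo \<open>Z\<close>. If
        \<open>W\<close> were \<open>A\<close>, then all of \<open>G\<close> would do so and would
        lie in \<open>A\<close>.\<close>
      have "W \<subseteq> A"
        using centralizer_mod_antimono[OF A_sub] Suc.prems(5) by (auto simp: W_def)
      moreover have "W \<noteq> A"
        using subset_centralizer_mod_sym[of A G "carrier G" Z] A_sub False Suc.prems(5)
        by (auto simp: W_def)
      ultimately show ?thesis by blast
    qed
    \<comment> \<open>\<open>W\<close> lies strictly between \<open>Z\<close> and \<open>A\<close>,
      where the total index is \<open>p^2\<close>, so both steps have index
      \<open>p\<close>.\<close>
    have cardA: "card A = p * card W"
    proof (rule antisym)
      have "p * card Z dvd card W"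
        using p_card_dvd_card[OF subgroup_axioms W.subgroup_axioms ZW] .
      then have "p * (p * card Z) \<le> p * card W"
        using card_subgroup_pos[OF W.subgroup_axioms] by (simp add: dvd_imp_le)
      then show "card A \<le> p * card W"
        using Suc.prems(4) by (simp add: power2_eq_square)
      show "p * card W \<le> card A"
        using p_card_dvd_card[OF W.subgroup_axioms Suc.prems(2) WA] card_subgroup_pos[OF Suc.prems(2)]
        by (simp add: dvd_imp_le)
    qed
    then have cardW: "card W = p * card Z"
      using Suc.prems(4) pos by (simp add: power2_eq_square)
    \<comment> \<open>In the induction, \<open>W\<close> and \<open>N\<close> take over from
      \<open>Z\<close> and \<open>A\<close>. It remains to see that \<open>N / W\<close> has order
      \<open>p^2\<close>, that is, that \<open>A\<close> has index \<open>p\<close> in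
      \<open>N\<close>.\<close>
    define N where "N = ?C W A"
    have N: "subgroup N G" unfolding N_def using A_sub by (rule W.subgroup_centralizer_mod)
    have "A \<subseteq> ?C Z A"
      using Suc.prems(1-4) by (rule subgroup_subset_centralizer_mod)
    then have AN: "A \<subseteq> N"
      using centralizer_mod_mono[OF Suc.prems(1) W_norm _ A_sub] ZW by (auto simp: N_def)
    \<comment> \<open>Otherwise the centre modulo \<open>W\<close> would be \<open>A\<close>, so that all of \<open>G\<close> centralizes \<open>A\<close> modulo \<open>W\<close>.\<close>
    have "A \<noteq> N"
    proof
      assume "A = N"
      then have "?C W A = A" unfolding N_def by (rule sym)
      then have "?C W (carrier G) \<subseteq> A"
        using centralizer_mod_antimono[OF A_sub, of G W] by simp
      moreover have "W \<subset> ?C W (carrier G)"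
        using WA A_sub by (intro center_mod_psupset[OF W_norm]) blast
      ultimately have "?C W (carrier G) = A"
        using W.subgroup_axioms Suc.prems(2) cardA
        by (intro subgroup_eq_of_p_card[of W]) (auto simp: W.subgroup_centralizer_mod)
      then have "carrier G \<subseteq> N"
        unfolding N_def using A_sub by (subst subset_centralizer_mod_sym) auto
      then show False using \<open>A = N\<close> A_sub False by blast
    qed
    then have "p * card A \<le> card N"
      using p_card_dvd_card[OF Suc.prems(2) N] AN card_subgroup_pos[OF N] by (simp add: dvd_imp_le psubset_eq)
    \<comment> \<open>For \<open>a\<close> in \<open>A\<close> outside \<open>W\<close>, the map sending \<open>g\<close> to \<open>[g, a]\<close> embeds \<open>N / A\<close> into \<open>W / Z\<close>.\<close>
    moreover have "card N \<le> p * card A"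
    proof -
      obtain a where a: "a \<in> A" "a \<notin> W" using WA by blast
      then have ac: "a \<in> carrier G" using A_sub by blast
      \<comment> \<open>Modulo \<open>Z\<close>, such an element commutes with \<open>W\<close> and
        with \<open>a\<close>, hence with \<open>A\<close>, because \<open>W\<close> has index
        \<open>p\<close> in \<open>A\<close>; and \<open>A\<close> contains its own
        centralizer.\<close>
      have "N \<inter> ?C Z {a} \<subseteq> A"
      proof
        fix y assume y: "y \<in> N \<inter> ?C Z {a}"
        then have yc: "y \<in> carrier G" by (simp add: centralizer_mod_def)
        have "W \<subseteq> ?C Z {y}"
          unfolding W_def using yc by (intro centralizer_mod_antimono) simp
        moreover have "{a} \<subseteq> ?C Z {y}"
          using y yc ac by (subst subset_centralizer_mod_sym) auto
        ultimately have "W \<subset> ?C Z {y} \<inter> A" using WA a by blast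
        then have "?C Z {y} \<inter> A = A"
          using W.subgroup_axioms Suc.prems(2) cardA yc
          by (intro subgroup_eq_of_p_card[of W])
            (auto simp: subgroup_centralizer_mod intro: subgroups_Inter_pair)
        then have "{y} \<subseteq> ?C Z A"
          using yc A_sub by (subst subset_centralizer_mod_sym) auto
        then show "y \<in> A" using Suc.prems(5) by blast
      qed
      then have "card (N \<inter> ?C Z {a}) \<le> card A"
        using A_sub finite_carrier by (meson card_mono finite_subset)
      moreover have "card N * card Z \<le> card W * card (N \<inter> ?C Z {a})"
        using a ZW ac N centralizer_mod_antimono[of "{a}" A]
        by (intro card_le_card_centralizer_mod[OF finite_carrier Suc.prems(1) W_norm]) (auto simp: N_def)
      ultimately have "card N * card Z \<le> card W * card A"
        by (meson le_trans mult_le_mono2)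
      then show ?thesis using cardW pos by (simp add: mult_ac)
    qed
    ultimately have cardN: "card N = p\<^sup>2 * card W"
      using cardA by (simp add: power2_eq_square)
    have "lower_central G k \<subseteq> W \<longleftrightarrow> c \<le> k" for k
    proof (rule Suc.IH[OF W_norm N _ cardN])
      show "W \<subseteq> N" using WA AN by blast
      \<comment> \<open>As \<open>N\<close> contains \<open>A\<close>, whatever centralizes
        \<open>N\<close> modulo \<open>W\<close> also centralizes \<open>A\<close> and so lies in
        \<open>N\<close>.\<close>
      show "?C W N \<subseteq> N"
        using centralizer_mod_antimono[OF AN, of G W] unfolding N_def .
      show "order G = p ^ Suc c * card W"
        using Suc.prems(6) cardW by (simp add: mult_ac)
    qed
    then show ?thesis
      using lower_central_subset_step[OF Zne] by (simp add: W_def)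
  qed
qed


section \<open>Non-abelian self-centralizing subgroups of order p^3\<close>

text \<open>The previous lemma applies to \<open>E\<close> modulo \<open>Z\<close>, the centre of
  \<open>G\<close>, and one central step leads from \<open>Z\<close> to the trivial group. That
  \<open>E\<close> is self-centralizing modulo \<open>Z\<close> comes from counting the conjugates
  of two non-commuting elements \<open>a\<close> and \<open>b\<close> of \<open>E\<close>: each
  choice costs a factor of at most \<open>p\<close>.\<close>

lemma (in p_group) lower_central_of_self_centralizing_p_cubed:
  assumes E: "subgroup E G" "card E = p ^ 3" "\<not> E \<subseteq> centralizer G E" "centralizer G E \<subseteq> E"
    and G: "order G = p ^ Suc c"
  shows "lower_central G k \<subseteq> {\<one>} \<longleftrightarrow> c \<le> k"
proof -
  have one_norm: "{\<one>} \<lhd> G" by (simp add: normal_inv_iff triv_subgroup)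
  interpret one: normal "{\<one>}" G by fact
  interpret H: p_group p "G\<lparr>carrier := E\<rparr>" using p_group_subgroup E(1) .
  let ?C = "centralizer_mod G"
  have p1: "p > 1" using prime_gt_1_nat[OF prime_p] .
  have E_sub: "E \<subseteq> carrier G" using E(1) by (rule subgroup.subset)
  have E_fin: "finite E" using E_sub finite_carrier finite_subset by blast
  define W where "W = ?C {\<one>} E"
  have W_eq: "W = centralizer G E" by (simp add: W_def centralizer_mod_one E_sub)
  have W: "subgroup W G" unfolding W_def using E_sub by (rule one.subgroup_centralizer_mod)
  have WE: "W \<subset> E" using E(3,4) by (auto simp: W_eq)
  \<comment> \<open>Since \<open>W\<close> lies in \<open>E\<close>, it is the centre of
    \<open>E\<close>; it cannot have index \<open>p\<close> there, so its order is at most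
    \<open>p\<close>.\<close>
  have W_H: "W = centralizer_mod (G\<lparr>carrier := E\<rparr>) {\<one>} E"
    using WE E_sub by (auto simp: W_def centralizer_mod_def r_coset_def)
  have "p * card W dvd card E" using p_card_dvd_card[OF W E(1) WE] .
  moreover have "p * card W \<noteq> p ^ 3"
    using H.order_neq_p_center_mod[of "{\<one>}"] normal_restrict_supergroup[OF E(1) one_norm]
      E(2) subgroup.one_closed[OF E(1)] by (simp add: W_H order_def)
  ultimately have "p * card W < p ^ 3" using E(2) p1 by (simp add: dvd_imp_le le_neq_implies_less)
  obtain i where i: "card W = p ^ i"
    using p_group.order_power[OF p_group_subgroup[OF W]] by (auto simp: order_def)
  have "i \<le> 1"
    using \<open>p * card W < p ^ 3\<close> p1 power_strict_increasing_iff[of p "Suc i" 3] by (simp add: i)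
  then have cardW_le: "card W \<le> p" using p1 by (cases i) (auto simp: i)
  define Z where "Z = ?C {\<one>} (carrier G)"
  have Z_norm: "Z \<lhd> G" unfolding Z_def by (rule one.normal_centralizer_mod_carrier)
  interpret Z: normal Z G by fact
  have G_ne: "{\<one>} \<noteq> carrier G" using G p1 by (auto simp: order_def dest: arg_cong[of _ _ card])
  have "{\<one>} \<subset> Z"
    unfolding Z_def using center_mod_psupset[OF one_norm G_ne] .
  moreover have "Z \<subseteq> W" unfolding W_def Z_def using E_sub by (rule centralizer_mod_antimono)
  \<comment> \<open>The centre of \<open>G\<close> is non-trivial and contained in \<open>W\<close>,
    which has order at most \<open>p\<close>.\<close>
  ultimately have ZW: "Z = W"
    using one.subgroup_axioms Z.subgroup_axioms W cardW_le
    by (intro subgroup_eq_of_p_card[of "{\<one>}"]) auto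
  have "p dvd card Z"
    using p_card_dvd_card[OF one.subgroup_axioms Z.subgroup_axioms \<open>{\<one>} \<subset> Z\<close>] by simp
  then have cardZ: "card Z = p"
    using cardW_le card_subgroup_pos[OF W] by (auto simp: ZW dest: dvd_imp_le)
  have cardE: "card E = p\<^sup>2 * card Z" by (simp add: E(2) cardZ power3_eq_cube power2_eq_square)
  define N where "N = ?C Z E"
  have N: "subgroup N G" unfolding N_def using E_sub by (rule Z.subgroup_centralizer_mod)
  have EN: "E \<subseteq> N"
    unfolding N_def using WE cardE by (intro subgroup_subset_centralizer_mod Z_norm E(1)) (auto simp: ZW)
  obtain a where a: "a \<in> E" "a \<notin> W" using WE by blast
  then have ac: "a \<in> carrier G" using E_sub by blast
  have "\<not> E \<subseteq> ?C {\<one>} {a}"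
    using subset_centralizer_mod_sym[of E G "{a}" "{\<one>}"] a ac E_sub by (auto simp: W_def)
  then obtain b where b: "b \<in> E" "b \<notin> ?C {\<one>} {a}" by blast
  then have bc: "b \<in> carrier G" using E_sub by blast
  \<comment> \<open>Elements of \<open>N\<close> move \<open>x\<close> only within its coset of
    \<open>Z\<close>, so \<open>x\<close> has at most \<open>p\<close> conjugates under
    \<open>M\<close>.\<close>
  have step: "card M \<le> p * card (M \<inter> ?C {\<one>} {x})"
    if "subgroup M G" "M \<subseteq> N" "x \<in> E" for M x
  proof -
    have "M \<subseteq> ?C Z {x}"
      using that centralizer_mod_antimono[of "{x}" E G Z] by (auto simp: N_def)
    then show ?thesis
      using card_le_card_centralizer_mod[OF finite_carrier one_norm Z_norm _ that(1)] that(3) E_sub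
        Z.one_closed by (auto simp: cardZ)
  qed
  let ?M = "N \<inter> ?C {\<one>} {a}"
  have M: "subgroup ?M G"
    using N ac by (simp add: subgroups_Inter_pair one.subgroup_centralizer_mod)
  \<comment> \<open>By its order, \<open>E\<close> is generated by \<open>Z\<close>, \<open>a\<close> and \<open>b\<close>.\<close>
  have "?M \<inter> ?C {\<one>} {b} \<subseteq> W"
  proof
    fix y assume y: "y \<in> ?M \<inter> ?C {\<one>} {b}"
    then have yc: "y \<in> carrier G" by (simp add: centralizer_mod_def)
    let ?Y = "?C {\<one>} {y}"
    let ?A = "?C {\<one>} {a}"
    have ab: "{a, b} \<subseteq> ?Y"
      using y yc ac bc by (subst subset_centralizer_mod_sym) (auto simp: centralizer_mod_def)
    have Y: "subgroup (?Y \<inter> E) G" "subgroup (?Y \<inter> E \<inter> ?A) G"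
      using yc ac E(1) by (simp_all add: subgroups_Inter_pair one.subgroup_centralizer_mod)
    \<comment> \<open>In the chain from \<open>Z\<close> to the centralizer of \<open>{y, a}\<close>
      in \<open>E\<close> to that of \<open>y\<close>, the first inclusion is strict because of
      \<open>a\<close> and the second because of \<open>b\<close>. Hence the centralizer of
      \<open>y\<close> in \<open>E\<close> has order at least \<open>p^3\<close>.\<close>
    have "Z \<subseteq> ?C {\<one>} {y} \<inter> ?A"
      unfolding Z_def using yc ac by (simp add: centralizer_mod_antimono)
    moreover have "a \<in> ?A" using ac by (simp add: centralizer_mod_def)
    ultimately have "Z \<subset> ?Y \<inter> E \<inter> ?A" using WE ab a ZW by blast
    then have "p * p dvd card (?Y \<inter> E \<inter> ?A)"
      using p_card_dvd_card[OF Z.subgroup_axioms Y(2)] by (simp add: cardZ)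
    moreover have "?Y \<inter> E \<inter> ?A \<subset> ?Y \<inter> E" using ab b by blast
    then have "p * card (?Y \<inter> E \<inter> ?A) dvd card (?Y \<inter> E)"
      using p_card_dvd_card[OF Y(2,1)] by blast
    ultimately have "p * (p * p) dvd card (?Y \<inter> E)"
      by (meson dvd_trans mult_dvd_mono dvd_refl)
    then have "card E \<le> card (?Y \<inter> E)"
      using card_subgroup_pos[OF Y(1)] by (simp add: dvd_imp_le E(2) power3_eq_cube mult.assoc)
    then have "?Y \<inter> E = E" using E_fin by (intro card_seteq) auto
    then have "{y} \<subseteq> W"
      unfolding W_def using yc E_sub by (subst subset_centralizer_mod_sym) auto
    then show "y \<in> W" by simp
  qed
  then have "card (?M \<inter> ?C {\<one>} {b}) \<le> p"
    using cardZ ZW WE E_fin by (metis card_mono finite_subset psubset_imp_subset)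
  then have "card ?M \<le> p * p"
    using step[OF M _ b(1)] by (meson inf_le1 le_trans mult_le_mono2)
  then have "card N \<le> p * (p * p)"
    using step[OF N _ a(1)] by (meson order_refl le_trans mult_le_mono2)
  then have "card N \<le> card E" by (simp add: E(2) power3_eq_cube mult.assoc)
  then have "N \<subseteq> E"
    using EN N finite_carrier by (metis card_seteq finite_subset order_refl subgroup.subset)
  \<comment> \<open>\<open>G / Z\<close> has order \<open>p ^ Suc d\<close>, so its class is
    \<open>d\<close>, one less than that of \<open>G\<close>.\<close>
  moreover obtain d where d: "c = Suc d"
  proof (cases c)
    case 0
    have "card E \<le> order G" using E_sub finite_carrier by (simp add: order_def card_mono)
    then show ?thesis using p1 power_increasing_iff[of p 3 1] by (simp add: E(2) G 0)
  qed
  ultimately have "lower_central G k \<subseteq> Z \<longleftrightarrow> d \<le> k" for k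
    using WE cardE G
    by (intro lower_central_of_self_centralizing_mod[OF Z_norm E(1)]) (auto simp: ZW N_def cardZ[unfolded ZW])
  then show ?thesis
    using one.lower_central_subset_step[OF G_ne] d by (simp add: Z_def)
qed

section \<open>Maximal class of the groups containing a pearl\<close>

lemma (in p_group) lower_central_of_pearl:
  assumes E: "subgroup E G" "centralizer G E \<subseteq> E"
    and "card E = p\<^sup>2 \<or> \<not> comm_group (G\<lparr>carrier := E\<rparr>) \<and> card E = p ^ 3"
    and G: "order G = p ^ Suc c"
  shows "lower_central G k \<subseteq> {\<one>} \<longleftrightarrow> c \<le> k"
proof (cases "card E = p\<^sup>2")
  case True
  have "{\<one>} \<lhd> G" by (simp add: normal_inv_iff triv_subgroup)
  then show ?thesis
    using E G True subgroup.one_closed[OF E(1)]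
    by (intro lower_central_of_self_centralizing_mod[of _ E])
      (auto simp: centralizer_mod_one subgroup.subset)
next
  case False
  have "comm_group (G\<lparr>carrier := E\<rparr>)" if "E \<subseteq> centralizer G E"
    using that subgroup.subgroup_is_group[OF E(1) is_group]
    by (intro group.group_comm_groupI) (auto simp: centralizer_def subset_iff)
  then show ?thesis
    using assms False by (intro lower_central_of_self_centralizing_p_cubed[of E]) auto
qed

lemma (in p_group) maximal_class_of_pearl:
  assumes E: "subgroup E G" "centralizer G E \<subseteq> E"
    and card: "card E = p\<^sup>2 \<or> \<not> comm_group (G\<lparr>carrier := E\<rparr>) \<and> card E = p ^ 3"
  shows "maximal_class p G"
proof -
  obtain n where n: "order G = p ^ n" using order_power by blast
  \<comment> \<open>This makes \<open>n\<close> positive, so that \<open>n - 1\<close> in the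
    definition of maximal class is \<open>c\<close>.\<close>
  have "p \<le> card E"
    using card prime_gt_1_nat[OF prime_p] by (auto simp: power2_eq_square power3_eq_cube)
  also have "card E \<le> order G"
    using E(1) finite_carrier by (simp add: order_def card_mono subgroup.subset)
  finally obtain c where c: "n = Suc c"
    using n prime_gt_1_nat[OF prime_p] by (cases n) auto
  have "\<one> \<in> lower_central G k" for k
    by (cases k) (auto simp: commutator_subgroup_def generate.one)
  then have "lower_central G k = {\<one>} \<longleftrightarrow> c \<le> k" for k
    using lower_central_of_pearl[OF assms] n c by auto
  then show ?thesis
    using n c p_group_axioms by (auto simp: maximal_class_def has_nilpotency_class_def)
qed

theorem lemma1p5:
  fixes p :: nat
    and S :: "('a, 'b) monoid_scheme"
    and F :: "'a set \<Rightarrow> 'a set \<Rightarrow> ('a \<Rightarrow> 'a) set"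
    and E :: "'a set"
  assumes "Factorial_Ring.prime p"
    and "p_group p S"
    and "saturated_fusion_system p S F"
    and "pearl p S F E"
  shows "(\<forall>P. subgroup P S \<and> E \<subseteq> P \<longrightarrow> maximal_class p (S\<lparr>carrier := P\<rparr>)) \<and> maximal_class p S"
proof -
  interpret saturated_fusion_system p S F by fact
  have E: "subgroup E S" "card E = p\<^sup>2 \<or> \<not> comm_group (S\<lparr>carrier := E\<rparr>) \<and> card E = p ^ 3"
    using assms(4) by (auto simp: pearl_def essential_def)
  have E_sub: "E \<subseteq> carrier S" using E(1) by (rule subgroup.subset)
  \<comment> \<open>Conjugation by the neutral element is the inclusion of \<open>E\<close> into
    \<open>S\<close>; the centralizer condition on essential subgroups, taken at this morphism, says
    that \<open>E\<close> contains its centralizer in \<open>S\<close>.\<close>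
  have id: "conj_map S \<one>\<^bsub>S\<^esub> E ` E = E"
    using E_sub by (auto simp: conj_map_def subset_iff)
  then have "conj_map S \<one>\<^bsub>S\<^esub> E \<in> F E (carrier S)"
    using E_sub by (intro conj_map_morphism E(1) subgroup_self) auto
  then have cent: "centralizer S E \<subseteq> E"
    using assms(4) id unfolding pearl_def essential_def by metis
  have "maximal_class p (S\<lparr>carrier := P\<rparr>)" if P: "subgroup P S" "E \<subseteq> P" for P
  proof -
    have "centralizer (S\<lparr>carrier := P\<rparr>) E \<subseteq> E"
      using cent subgroup.subset[OF P(1)] by (auto simp: centralizer_def)
    then show ?thesis
      using p_group.maximal_class_of_pearl[OF p_group_subgroup[OF P(1)]] E
        subgroup_incl[OF E(1) P] by auto
  qed
  then show ?thesis
    using maximal_class_of_pearl[OF E(1) cent E(2)] by blast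
qed

end
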